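(* Let $M$ be a matroid and $k$ a positive integer such that $a(M)>k$ (equivalently, $D(M)>k$). Let $\mathcal B$ be the base family of $M$ and $r$ the rank function of $M$. Let $\eta^*_1<\eta^*_2<\dots<\eta^*_m$ be the $m$ distinct values of the universal density $\eta^*$ of $M$. Define subsets $S_i\subseteq E(M)$ by $$S_i=\{e\in E(M):\eta^*(e)\le\eta^*_i\}\qquad(i=1,2,\dots,m).$$ Note that $\eta^*_1=1/D(M)<1/k$. Let $i(k)$ denote the largest subscript such that $\eta^*_{i(k)}\le 1/k$. Then $$N(M,k)=|E(M)-S_{i(k)}|+k\,r(S_{i(k)}).$$
   Context: All matroids are finite, loopless and of positive rank (unweighted here). $a(M)$ is the minimum number of bases of $M$ whose union is the ground set $E(M)$. $D(M)=\max\{|X|/r(X):X\subseteq E(M),\ r(X)>0\}$. $N(M,k)$ is the maximum integer $l>0$ such that there is $X\subseteq E(M)$ with $|X|=l$ and $a(M|X)\le k$, where $M|X$ is the restriction of $M$ to $X$. The universal density $\eta^*$ of $M$ is the unique minimizer of $\sum_{e\in E(M)}\eta(e)^2$ over the convex hull of the indicator vectors of the bases of $M$. *)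

theory Defs
  imports "HOL-Analysis.Analysis" "HOL-Library.Function_Algebras"
begin

text \<open>
  Pointwise scalar multiplication makes the real-valued functions a real vector space, so that
  the library's \<open>convex hull\<close> applies to indicator vectors \<open>'a \<Rightarrow> real\<close>.
\<close>

instantiation "fun" :: (type, real_vector) real_vector
begin

definition scaleR_fun :: "real \<Rightarrow> ('a \<Rightarrow> 'b) \<Rightarrow> 'a \<Rightarrow> 'b"
  where "scaleR_fun c f = (\<lambda>x. c *\<^sub>R f x)"

instance
  by standard (auto simp: scaleR_fun_def fun_eq_iff algebra_simps)

end

locale matroid =
  fixes E :: "'a set" and indep :: "'a set \<Rightarrow> bool"
  assumes finite_ground: "finite E"
    and indep_subset_ground: "indep I \<Longrightarrow> I \<subseteq> E"
    and indep_empty: "indep {}"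
    and indep_subset: "indep I \<Longrightarrow> J \<subseteq> I \<Longrightarrow> indep J"
    and augment: "indep I \<Longrightarrow> indep J \<Longrightarrow> card I < card J \<Longrightarrow> \<exists>x\<in>J - I. indep (insert x I)"

locale loopless_matroid = matroid +
  assumes loopless: "e \<in> E \<Longrightarrow> indep {e}"

definition bases :: "'a set \<Rightarrow> ('a set \<Rightarrow> bool) \<Rightarrow> 'a set set" where
  "bases E indep = {B. B \<subseteq> E \<and> indep B \<and> (\<forall>I. I \<subseteq> E \<and> indep I \<and> B \<subseteq> I \<longrightarrow> I = B)}"

definition rank_fn :: "('a set \<Rightarrow> bool) \<Rightarrow> 'a set \<Rightarrow> nat" where
  "rank_fn indep X = Max {card I | I. I \<subseteq> X \<and> indep I}"

text \<open>The restriction \<open>M|X\<close> is the matroid with ground set \<open>X\<close> and independence \<open>restrict_indep indep X\<close>.\<close>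

definition restrict_indep :: "('a set \<Rightarrow> bool) \<Rightarrow> 'a set \<Rightarrow> 'a set \<Rightarrow> bool" where
  "restrict_indep indep X I \<longleftrightarrow> I \<subseteq> X \<and> indep I"

definition covering_number :: "'a set \<Rightarrow> ('a set \<Rightarrow> bool) \<Rightarrow> nat" where
  "covering_number E indep =
     (LEAST n. \<exists>\<C>. \<C> \<subseteq> bases E indep \<and> finite \<C> \<and> card \<C> = n \<and> \<Union>\<C> = E)"

definition max_density :: "'a set \<Rightarrow> ('a set \<Rightarrow> bool) \<Rightarrow> real" where
  "max_density E indep =
     Max {real (card X) / real (rank_fn indep X) | X. X \<subseteq> E \<and> rank_fn indep X > 0}"

definition max_coverable :: "'a set \<Rightarrow> ('a set \<Rightarrow> bool) \<Rightarrow> nat \<Rightarrow> nat" where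
  "max_coverable E indep k =
     Max {l. l > 0 \<and> (\<exists>X\<subseteq>E. card X = l \<and> covering_number X (restrict_indep indep X) \<le> k)}"

definition base_polytope :: "'a set \<Rightarrow> ('a set \<Rightarrow> bool) \<Rightarrow> ('a \<Rightarrow> real) set" where
  "base_polytope E indep = convex hull (indicator ` bases E indep)"

text \<open>
  Points of the base polytope vanish outside \<open>E\<close>, so the minimizer is unique also as a function
  on the whole type.
\<close>

definition universal_density :: "'a set \<Rightarrow> ('a set \<Rightarrow> bool) \<Rightarrow> 'a \<Rightarrow> real" where
  "universal_density E indep =
     (THE \<eta>. \<eta> \<in> base_polytope E indep \<and>
        (\<forall>\<eta>'\<in>base_polytope E indep. (\<Sum>e\<in>E. (\<eta> e)\<^sup>2) \<le> (\<Sum>e\<in>E. (\<eta>' e)\<^sup>2)))"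

end

theory Submission imports Defs begin

text \<open>
  A set has covering number at most \<open>k\<close> iff it splits into \<open>k\<close> independent sets, that is, iff it has
  a proper colouring with \<open>k\<close> colours (\<open>covering_number_restrict_le_iff\<close>). Such a set \<open>X\<close> satisfies
  \<open>|X| \<le> |E - Y| + k r(Y)\<close> for every \<open>Y\<close>, since each colour class has at most \<open>r(Y)\<close> elements in \<open>Y\<close>.
  The matroid union theorem (\<open>matroid_union\<close>, \<open>max_colourable_set\<close>) gives an \<open>X\<close> and a \<open>Y\<close> with
  equality. So the largest \<open>|X|\<close> is the minimum of \<open>|E - Y| + k r(Y)\<close> over \<open>Y\<close>, and the whole ground
  set is colourable iff \<open>|X| \<le> k r(X)\<close> for all \<open>X\<close>, which compares the covering number with the
  maximum density.

  It remains to see that the level set \<open>S\<close> of \<open>\<eta>\<close> at \<open>1/k\<close> attains this minimum, that is,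
  minimises \<open>k r(Y) - |Y|\<close>. Every point of the base polytope satisfies \<open>\<eta>(Y) \<le> r(Y)\<close>, so
  \<open>k r(Y) - |Y|\<close> is at least the sum of \<open>k \<eta>(e) - 1\<close> over \<open>Y\<close>. Since \<open>S\<close> collects exactly the
  elements with nonpositive summand, \<open>S\<close> minimises this sum. Optimality of \<open>\<eta>\<close> makes level sets
  tight, \<open>\<eta>(S) = r(S)\<close> (\<open>level_set_tight\<close>), so at \<open>Y = S\<close> the bound is an equality. Tightness of
  the lowest level set also identifies the least value of \<open>\<eta>\<close> with the reciprocal of the maximum
  density (\<open>min_universal_density\<close>).
\<close>

section \<open>Independent sets and rank\<close>

lemma card_exchange:
  assumes "finite A" "c \<in> A" "y \<notin> A"
  shows "card (insert y (A - {c})) = card A"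
proof -
  have "card (insert y (A - {c})) = Suc (card (A - {c}))"
    using assms by (intro card_insert_disjoint) auto
  then show ?thesis using card_Suc_Diff1[OF assms(1,2)] by (rule trans)
qed

lemma single_exchange:
  assumes "finite A" "finite K" "card K = card A" "K \<subseteq> insert y A" "y \<in> K" "y \<notin> A"
  obtains c where "c \<in> A" "c \<notin> K" "K = insert y (A - {c})"
proof -
  have "\<not> A \<subseteq> K"
    using card_subset_eq[OF assms(2), of A] assms by auto
  then obtain c where c: "c \<in> A" "c \<notin> K" by blast
  have "card (insert y (A - {c})) = card A"
    using c assms by (intro card_exchange) auto
  then have "K = insert y (A - {c})"
    using assms c by (intro card_subset_eq) auto
  then show ?thesis using c that by blast
qed

context matroid
begin

lemma finite_indep: "indep I \<Longrightarrow> finite I"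
  using finite_ground indep_subset_ground finite_subset by blast

lemma indep_extend:
  assumes "indep I" "indep J" "card I \<le> card J"
  obtains K where "I \<subseteq> K" "K \<subseteq> I \<union> J" "indep K" "card K = card J"
proof -
  have "\<exists>K. I \<subseteq> K \<and> K \<subseteq> I \<union> J \<and> indep K \<and> card K = card J"
    using assms
  proof (induction "card J - card I" arbitrary: I)
    case 0
    then show ?case by auto
  next
    case (Suc n)
    then have "card I < card J" by simp
    then obtain x where x: "x \<in> J - I" "indep (insert x I)"
      using augment[of I J] Suc.prems by blast
    have c: "card (insert x I) = Suc (card I)"
      using x Suc.prems finite_indep by auto
    then have "\<exists>K. insert x I \<subseteq> K \<and> K \<subseteq> insert x I \<union> J \<and> indep K \<and> card K = card J"
      using Suc.hyps(2) x Suc.prems by (intro Suc.hyps(1)) auto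
    then show ?case using x by blast
  qed
  then show ?thesis using that by blast
qed

lemma finite_indep_cards: "finite {card I |I. I \<subseteq> X \<and> indep I}"
proof -
  have "{card I |I. I \<subseteq> X \<and> indep I} \<subseteq> card ` Pow E"
    using indep_subset_ground by auto
  then show ?thesis using finite_ground finite_subset by blast
qed

lemma card_indep_le_rank: "indep I \<Longrightarrow> I \<subseteq> X \<Longrightarrow> card I \<le> rank_fn indep X"
  unfolding rank_fn_def by (rule Max_ge[OF finite_indep_cards]) auto

lemma rank_attained:
  obtains I where "indep I" "I \<subseteq> X" "card I = rank_fn indep X"
proof -
  have "rank_fn indep X \<in> {card I |I. I \<subseteq> X \<and> indep I}"
    unfolding rank_fn_def using indep_empty by (intro Max_in finite_indep_cards) blast
  then show ?thesis using that by force
qed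

lemma rank_le_card: "finite X \<Longrightarrow> rank_fn indep X \<le> card X"
proof -
  assume "finite X"
  obtain I where "I \<subseteq> X" "card I = rank_fn indep X" by (rule rank_attained)
  then show ?thesis using card_mono[OF \<open>finite X\<close>] by metis
qed

lemma bases_iff: "B \<in> bases E indep \<longleftrightarrow> indep B \<and> card B = rank_fn indep E"
proof
  assume B: "B \<in> bases E indep"
  obtain I where I: "indep I" "I \<subseteq> E" "card I = rank_fn indep E" by (rule rank_attained)
  have le: "card B \<le> rank_fn indep E"
    using B by (auto simp: bases_def intro: card_indep_le_rank)
  have "indep B" using B by (simp add: bases_def)
  then obtain K where "B \<subseteq> K" "indep K" "card K = card I"
    using indep_extend[of B I] I le by metis
  moreover from this have "K = B"
    using B indep_subset_ground by (auto simp: bases_def)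
  ultimately show "indep B \<and> card B = rank_fn indep E"
    using I by simp
next
  assume B: "indep B \<and> card B = rank_fn indep E"
  have "I = B" if "I \<subseteq> E" "indep I" "B \<subseteq> I" for I
    using card_seteq[of I B] card_indep_le_rank[of I E] that B finite_indep[of I] by simp
  then show "B \<in> bases E indep"
    using B indep_subset_ground by (auto simp: bases_def)
qed

lemma finite_bases: "finite (bases E indep)"
  by (rule finite_subset[of _ "Pow E"]) (auto simp: bases_def finite_ground)

lemma bases_nonempty: "bases E indep \<noteq> {}"
proof -
  obtain I where "indep I" "card I = rank_fn indep E" by (rule rank_attained)
  then show ?thesis using bases_iff by auto
qed

lemma indep_subset_base:
  assumes "indep I"
  obtains B where "B \<in> bases E indep" "I \<subseteq> B"
proof -
  obtain J where J: "indep J" "card J = rank_fn indep E" by (rule rank_attained)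
  have "card I \<le> card J"
    using J assms card_indep_le_rank indep_subset_ground by metis
  then show ?thesis
    using indep_extend[OF assms J(1)] J(2) that bases_iff by metis
qed

text \<open>
  A fundamental circuit without circuits: the elements of an independent set \<open>A\<close> that can be
  exchanged for \<open>y\<close> already span \<open>y\<close>. Otherwise they and \<open>y\<close> extend inside \<open>insert y A\<close> to an
  independent set that omits a single element of \<open>A\<close>, and that element is exchangeable for \<open>y\<close>.
\<close>

lemma exchangeable_elements_span:
  assumes A: "indep A" and y: "y \<notin> A" "\<not> indep (insert y A)"
  shows "\<not> indep (insert y {c \<in> A. indep (insert y (A - {c}))})"
proof
  let ?D = "{c \<in> A. indep (insert y (A - {c}))}"
  assume D: "indep (insert y ?D)"
  have fin: "finite A" using A finite_indep by auto
  have "?D \<noteq> A" using D y by force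
  then have "?D \<subset> A" by blast
  then have "card (insert y ?D) \<le> card A"
    using fin psubset_card_mono[of A ?D] y by (simp add: card_insert_if)
  then obtain K where K: "insert y ?D \<subseteq> K" "K \<subseteq> insert y ?D \<union> A" "indep K" "card K = card A"
    using indep_extend[OF D A] by blast
  obtain c where c: "c \<in> A" "c \<notin> K" "K = insert y (A - {c})"
    using single_exchange[of A K y] K y fin finite_indep by auto
  then have "c \<in> ?D" using c K by simp
  then show False using c K by auto
qed

text \<open>
  For independent \<open>A\<close> this is membership of the ground element \<open>z\<close> in the closure of \<open>A\<close>.
\<close>

definition spans :: "'a set \<Rightarrow> 'a \<Rightarrow> bool" where
  "spans A z \<longleftrightarrow> z \<in> A \<or> \<not> indep (insert z A)"

text \<open>
  If \<open>A'\<close> did not span \<open>z\<close>, then \<open>insert z A'\<close> would be larger than \<open>A\<close> and hence augment it; but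
  \<open>A\<close> spans \<open>z\<close> and every element of \<open>A'\<close>.
\<close>

lemma spans_transfer:
  assumes "indep A" "indep A'" "card A \<le> card A'" "\<And>x. x \<in> A' \<Longrightarrow> spans A x" "spans A z"
  shows "spans A' z"
proof (rule ccontr)
  assume "\<not> spans A' z"
  then have z: "z \<notin> A'" "indep (insert z A')" by (auto simp: spans_def)
  then have "card A < card (insert z A')"
    using assms(2,3) finite_indep by (simp add: card_insert_if)
  then obtain x where "x \<in> insert z A' - A" "indep (insert x A)"
    using augment[OF assms(1) z(2)] by blast
  then show False using assms(4,5) by (auto simp: spans_def)
qed

lemma rank_eq_card_if_spans:
  assumes "indep A" "A \<subseteq> Y" "\<And>y. y \<in> Y \<Longrightarrow> spans A y"
  shows "rank_fn indep Y = card A"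
proof (rule ccontr)
  obtain J where J: "indep J" "J \<subseteq> Y" "card J = rank_fn indep Y" by (rule rank_attained)
  assume "rank_fn indep Y \<noteq> card A"
  then have "card A < card J" using card_indep_le_rank[OF assms(1,2)] J by simp
  then obtain x where "x \<in> J - A" "indep (insert x A)"
    using augment[OF assms(1) J(1)] by blast
  then show False using assms(3) J by (auto simp: spans_def)
qed

end

section \<open>Partitioning into independent sets\<close>

definition colourable :: "('a set \<Rightarrow> bool) \<Rightarrow> nat \<Rightarrow> 'a set \<Rightarrow> bool" where
  "colourable indep k X \<longleftrightarrow> (\<exists>f. (\<forall>e\<in>X. f e < k) \<and> (\<forall>i<k. indep {e \<in> X. f e = i}))"

context matroid
begin

text \<open>
  A family of \<open>k\<close> disjoint independent sets is written as a colouring \<open>f\<close>: the members are the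
  classes of the colours below \<open>k\<close>, so disjointness is automatic, and colour \<open>k\<close> marks the elements
  that no member contains.
\<close>

definition partial_colouring :: "nat \<Rightarrow> ('a \<Rightarrow> nat) \<Rightarrow> bool" where
  "partial_colouring k f \<longleftrightarrow> (\<forall>i<k. indep {e \<in> E. f e = i}) \<and> (\<forall>e\<in>E. f e \<le> k)"

text \<open>
  A swap gives the uncoloured \<open>y\<close> the colour of \<open>c\<close> and uncolours \<open>c\<close>, as far as the changed class
  stays independent. The number of uncoloured elements does not change.
\<close>

inductive swap_reachable :: "nat \<Rightarrow> ('a \<Rightarrow> nat) \<Rightarrow> ('a \<Rightarrow> nat) \<Rightarrow> bool" for k f0 where
  initial: "swap_reachable k f0 f0"
| step: "\<lbrakk>swap_reachable k f0 f; y \<in> E; f y = k; c \<in> E; f c < k;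
     indep (insert y ({e \<in> E. f e = f c} - {c}))\<rbrakk>
   \<Longrightarrow> swap_reachable k f0 (f(y := f c, c := k))"

lemma class_swap:
  fixes f :: "'a \<Rightarrow> nat"
  assumes "y \<in> E" "f y = k" "c \<in> E" "f c < k"
  shows "{e \<in> E. (f(y := f c, c := k)) e = f c} = insert y ({e \<in> E. f e = f c} - {c})"
    and "i < k \<Longrightarrow> i \<noteq> f c \<Longrightarrow> {e \<in> E. (f(y := f c, c := k)) e = i} = {e \<in> E. f e = i}"
    and "{e \<in> E. (f(y := f c, c := k)) e = k} = insert c ({e \<in> E. f e = k} - {y})"
proof -
  have "c \<noteq> y" using assms by auto
  then show "{e \<in> E. (f(y := f c, c := k)) e = f c} = insert y ({e \<in> E. f e = f c} - {c})"
    and "i < k \<Longrightarrow> i \<noteq> f c \<Longrightarrow> {e \<in> E. (f(y := f c, c := k)) e = i} = {e \<in> E. f e = i}"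
    and "{e \<in> E. (f(y := f c, c := k)) e = k} = insert c ({e \<in> E. f e = k} - {y})"
    using assms by auto
qed

lemma swap_reachable_invariant:
  assumes "swap_reachable k f0 f" "partial_colouring k f0"
  shows "partial_colouring k f \<and> card {e \<in> E. f e = k} = card {e \<in> E. f0 e = k}"
  using assms
proof (induction rule: swap_reachable.induct)
  case initial
  then show ?case by simp
next
  case (step f y c)
  let ?g = "f(y := f c, c := k)"
  note cl = class_swap[of y f k c, OF step.hyps(2-5)]
  have f: "partial_colouring k f" using step by blast
  have "indep {e \<in> E. ?g e = i}" if "i < k" for i
    using f step.hyps(6) cl(1,2) that unfolding partial_colouring_def by (cases "i = f c") metis+
  then have "partial_colouring k ?g"
    using f step.hyps(5) by (auto simp: partial_colouring_def)
  moreover have "card {e \<in> E. ?g e = k} = card {e \<in> E. f e = k}"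
  proof -
    have "finite {e \<in> E. f e = k}" "y \<in> {e \<in> E. f e = k}" "c \<notin> {e \<in> E. f e = k}"
      using finite_ground step.hyps by auto
    then show ?thesis unfolding cl(3) by (rule card_exchange)
  qed
  ultimately show ?case using step.IH step.prems by (simp del: fun_upd_apply)
qed

text \<open>
  The matroid union theorem for \<open>k\<close> copies of one matroid. Starting from a colouring with as few
  uncoloured elements as possible, let \<open>Y\<close> collect every element that some sequence of swaps leaves
  uncoloured. An uncoloured \<open>y\<close> is spanned in each colour class by the elements exchangeable for it,
  which lie in \<open>Y\<close>, so already the part of the class in \<open>Y\<close> spans \<open>y\<close>. A swap replaces one element of
  such a part by another one that the part spans, so these parts never change their span. Hence in
  the initial colouring every class meets \<open>Y\<close> in a maximal independent subset of \<open>Y\<close>.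
\<close>

theorem matroid_union:
  obtains f Y where "partial_colouring k f" "Y \<subseteq> E" "{e \<in> E. f e = k} \<subseteq> Y"
    "\<And>i. i < k \<Longrightarrow> card {e \<in> Y. f e = i} = rank_fn indep Y"
proof -
  define unc where "unc f = card {e \<in> E. f e = k}" for f :: "'a \<Rightarrow> nat"
  have "partial_colouring k (\<lambda>_. k)" by (auto simp: partial_colouring_def indep_empty)
  then obtain f0 where f0: "partial_colouring k f0"
    and opt: "\<And>f. partial_colouring k f \<Longrightarrow> unc f0 \<le> unc f"
    using ex_has_least_nat[of "partial_colouring k" _ unc] by blast
  define Y where "Y = {y \<in> E. \<exists>f. swap_reachable k f0 f \<and> f y = k}"
  define part where "part f i = {e \<in> Y. f e = i}" for f :: "'a \<Rightarrow> nat" and i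
  have YE: "Y \<subseteq> E" by (auto simp: Y_def)
  have part_indep: "indep (part f i)" if "swap_reachable k f0 f" "i < k" for f i
  proof -
    have "indep {e \<in> E. f e = i}"
      using swap_reachable_invariant[OF that(1) f0] that(2) by (simp add: partial_colouring_def)
    then show ?thesis by (rule indep_subset) (use YE in \<open>auto simp: part_def\<close>)
  qed
  have part_spans: "spans (part f i) y"
    if f: "swap_reachable k f0 f" and y: "y \<in> E" "f y = k" and i: "i < k" for f y i
  proof -
    let ?A = "{e \<in> E. f e = i}"
      and ?D = "{c \<in> {e \<in> E. f e = i}. indep (insert y ({e \<in> E. f e = i} - {c}))}"
    have pf: "partial_colouring k f" and uf: "unc f = unc f0"
      using swap_reachable_invariant[OF f f0] by (auto simp: unc_def)
    have A: "indep ?A" using pf i by (simp add: partial_colouring_def)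
    have yA: "y \<notin> ?A" using y i by simp
    \<comment> \<open>Otherwise colouring \<open>y\<close> with \<open>i\<close> would leave fewer elements uncoloured than the optimum.\<close>
    have dep: "\<not> indep (insert y ?A)"
    proof
      assume ind: "indep (insert y ?A)"
      have "indep {e \<in> E. (f(y := i)) e = j}" if "j < k" for j
      proof (cases "j = i")
        case True
        then have "{e \<in> E. (f(y := i)) e = j} = insert y ?A" using y by auto
        then show ?thesis using ind by simp
      next
        case False
        then have "{e \<in> E. (f(y := i)) e = j} = {e \<in> E. f e = j}" using y that by auto
        then show ?thesis using pf that by (simp add: partial_colouring_def)
      qed
      then have "partial_colouring k (f(y := i))"
        using pf i by (auto simp: partial_colouring_def)
      then have "unc f0 \<le> unc (f(y := i))" by (rule opt)
      moreover have "unc (f(y := i)) < unc f"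
        unfolding unc_def using y i finite_ground by (intro psubset_card_mono) auto
      ultimately show False using uf by simp
    qed
    have "\<not> indep (insert y ?D)"
      by (rule exchangeable_elements_span[OF A yA dep])
    moreover have "insert y ?D \<subseteq> insert y (part f i)"
    proof -
      have "c \<in> Y" if "c \<in> ?D" for c
      proof -
        have c: "c \<in> E" "f c = i" "indep (insert y ({e \<in> E. f e = f c} - {c}))" using that by auto
        then have "swap_reachable k f0 (f(y := f c, c := k))"
          using swap_reachable.step[OF f y] i by blast
        then show ?thesis
          using c unfolding Y_def by (intro CollectI conjI exI[of _ "f(y := f c, c := k)"]) auto
      qed
      then show ?thesis by (auto simp: part_def)
    qed
    ultimately show ?thesis using indep_subset unfolding spans_def by blast
  qed
  have span_back: "spans (part f i) z \<Longrightarrow> spans (part f0 i) z"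
    if "swap_reachable k f0 f" "i < k" for f i z
    using that
  proof (induction arbitrary: z rule: swap_reachable.induct)
    case initial
    then show ?case by simp
  next
    case (step f y c)
    let ?g = "f(y := f c, c := k)"
    have g: "swap_reachable k f0 ?g" by (rule swap_reachable.step) fact+
    show ?case
    proof (cases "i = f c")
      case False
      then have "part ?g i = part f i" using step.hyps \<open>i < k\<close> by (auto simp: part_def)
      then show ?thesis using step.IH step.prems by (simp del: fun_upd_apply)
    next
      case True
      let ?P = "part f i" and ?Q = "part ?g i"
      have yY: "y \<in> Y" using step.hyps by (auto simp: Y_def)
      have cY: "c \<in> Y" unfolding Y_def using g step.hyps by (intro CollectI conjI exI[of _ ?g]) auto
      have Q: "?Q = insert y (?P - {c})"
        using True step.hyps yY by (auto simp: part_def)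
      have P: "indep ?P" and Qi: "indep ?Q" using part_indep step.hyps(1) g \<open>i < k\<close> by auto
      have cP: "c \<in> ?P" "y \<notin> ?P" using True cY step.hyps by (auto simp: part_def)
      have "card ?Q = card ?P"
        unfolding Q by (rule card_exchange[OF finite_indep[OF P] cP])
      moreover have "spans ?Q x" if "x \<in> ?P" for x
      proof (cases "x = c")
        case True
        \<comment> \<open>Undoing the swap: adding \<open>c\<close> back yields the dependent set \<open>insert y ?P\<close>.\<close>
        have "insert c ?Q = insert y ?P" using Q cP by auto
        moreover have "\<not> indep (insert y ?P)"
          using part_spans[OF step.hyps(1-3) \<open>i < k\<close>] cP by (simp add: spans_def)
        ultimately show ?thesis using True by (simp add: spans_def)
      next
        case False
        then show ?thesis using that Q by (simp add: spans_def)
      qed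
      ultimately have "spans ?P z" using spans_transfer[OF Qi P] step.prems by (simp del: fun_upd_apply)
      then show ?thesis using step.IH step.prems by (simp del: fun_upd_apply)
    qed
  qed
  show ?thesis
  proof
    show "partial_colouring k f0" "Y \<subseteq> E" by fact+
    show "{e \<in> E. f0 e = k} \<subseteq> Y" by (auto simp: Y_def intro: swap_reachable.initial)
    fix i assume i: "i < k"
    have "spans (part f0 i) y" if "y \<in> Y" for y
      using that part_spans span_back i unfolding Y_def by blast
    then have "rank_fn indep Y = card (part f0 i)"
      using part_indep[OF swap_reachable.initial i] by (intro rank_eq_card_if_spans) (auto simp: part_def)
    then show "card {e \<in> Y. f0 e = i} = rank_fn indep Y" by (simp add: part_def)
  qed
qed

lemma card_colourable_Int_le:
  assumes "colourable indep k X"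
  shows "card (X \<inter> S) \<le> k * rank_fn indep S"
proof -
  obtain f where f: "\<forall>e\<in>X. f e < k" "\<forall>i<k. indep {e \<in> X. f e = i}"
    using assms by (auto simp: colourable_def)
  have "X \<inter> S = (\<Union>i<k. {e \<in> X \<inter> S. f e = i})" using f by auto
  then have "card (X \<inter> S) \<le> (\<Sum>i<k. card {e \<in> X \<inter> S. f e = i})"
    using card_UN_le[OF finite_lessThan[of k], of "\<lambda>i. {e \<in> X \<inter> S. f e = i}"] by (rule ssubst)
  also have "\<dots> \<le> (\<Sum>i<k. rank_fn indep S)"
  proof (rule sum_mono)
    fix i assume "i \<in> {..<k}"
    then have "indep {e \<in> X \<inter> S. f e = i}"
      using f(2) indep_subset[of "{e \<in> X. f e = i}" "{e \<in> X \<inter> S. f e = i}"] by auto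
    then show "card {e \<in> X \<inter> S. f e = i} \<le> rank_fn indep S"
      by (intro card_indep_le_rank) auto
  qed
  finally show ?thesis by simp
qed

lemma card_colourable_le:
  assumes "colourable indep k X" "X \<subseteq> E"
  shows "card X \<le> card (E - S) + k * rank_fn indep S"
proof -
  have "card X = card (X \<inter> S) + card (X - S)"
    using assms(2) finite_ground by (metis card_Int_Diff finite_subset)
  moreover have "card (X - S) \<le> card (E - S)"
    using assms(2) finite_ground by (intro card_mono) auto
  ultimately show ?thesis using card_colourable_Int_le[OF assms(1), of S] by simp
qed

text \<open>
  Take the coloured elements of an optimal colouring for \<open>X\<close>: all of \<open>E - Y\<close> is coloured, and inside
  \<open>Y\<close> each of the \<open>k\<close> colours occurs \<open>r(Y)\<close> times.
\<close>

lemma max_colourable_set: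
  obtains X Y where "colourable indep k X" "X \<subseteq> E" "Y \<subseteq> E"
    "card X = card (E - Y) + k * rank_fn indep Y"
proof -
  obtain f Y where f: "partial_colouring k f" "Y \<subseteq> E" "{e \<in> E. f e = k} \<subseteq> Y"
    and r: "\<And>i. i < k \<Longrightarrow> card {e \<in> Y. f e = i} = rank_fn indep Y"
    using matroid_union[of k] by blast
  define X where "X = {e \<in> E. f e < k}"
  have "{e \<in> X. f e = i} = {e \<in> E. f e = i}" if "i < k" for i using that by (auto simp: X_def)
  then have "colourable indep k X"
    using f(1) unfolding colourable_def partial_colouring_def by (intro exI[of _ f]) (auto simp: X_def)
  moreover have "X - Y = E - Y"
    using f(1,3) by (force simp: X_def partial_colouring_def)
  moreover have "card (X \<inter> Y) = k * rank_fn indep Y"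
  proof -
    have "X \<inter> Y = (\<Union>i<k. {e \<in> Y. f e = i})" using f(2) by (auto simp: X_def)
    moreover have "card (\<Union>i<k. {e \<in> Y. f e = i}) = (\<Sum>i<k. card {e \<in> Y. f e = i})"
      using finite_subset[OF f(2) finite_ground] by (subst card_UN_disjoint) auto
    ultimately show ?thesis using r by simp
  qed
  moreover have "card X = card (X \<inter> Y) + card (X - Y)"
    using finite_ground by (intro card_Int_Diff) (simp add: X_def)
  ultimately show ?thesis using that[of X Y] f(2) by (simp add: X_def)
qed

text \<open>
  Edmonds' covering theorem. Under the rank condition the equality for a maximum colourable \<open>X\<close> gives
  \<open>|X| \<ge> |E - Y| + |Y| = |E|\<close>.
\<close>

lemma colourable_iff_rank:
  "colourable indep k E \<longleftrightarrow> (\<forall>X\<subseteq>E. card X \<le> k * rank_fn indep X)"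
proof
  assume "colourable indep k E"
  then show "\<forall>X\<subseteq>E. card X \<le> k * rank_fn indep X"
    using card_colourable_Int_le by (metis Int_absorb1)
next
  assume le: "\<forall>X\<subseteq>E. card X \<le> k * rank_fn indep X"
  obtain X Y where X: "colourable indep k X" "X \<subseteq> E" "Y \<subseteq> E"
    "card X = card (E - Y) + k * rank_fn indep Y" using max_colourable_set[of k] by blast
  have "card E = card (E - Y) + card Y"
    using X(3) finite_ground by (metis card_Diff_subset card_mono finite_subset le_add_diff_inverse2)
  then have "card E \<le> card X" using le X by auto
  then have "X = E" using X finite_ground card_seteq by metis
  then show "colourable indep k E" using X by simp
qed

end

section \<open>The covering number\<close>

context loopless_matroid
begin

lemma rank_pos: "X \<subseteq> E \<Longrightarrow> X \<noteq> {} \<Longrightarrow> rank_fn indep X > 0"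
  using card_indep_le_rank[of "{e}" X for e] loopless by fastforce

text \<open>
  A cover by bases yields a colouring by sending each element to one base that contains it, and
  conversely every colour class extends to a base. In a loopless matroid all bases together form a
  cover, so that the minimum in the covering number is attained.
\<close>

lemma covering_number_le_iff: "covering_number E indep \<le> k \<longleftrightarrow> colourable indep k E"
proof
  let ?P = "\<lambda>n. \<exists>\<C>. \<C> \<subseteq> bases E indep \<and> finite \<C> \<and> card \<C> = n \<and> \<Union>\<C> = E"
  have "\<Union>(bases E indep) = E"
  proof
    show "\<Union>(bases E indep) \<subseteq> E" by (auto simp: bases_def)
    show "E \<subseteq> \<Union>(bases E indep)"
      using loopless indep_subset_base by (metis Union_iff insert_subset subsetI)
  qed
  then have "?P (card (bases E indep))" using finite_bases by blast
  then have "?P (covering_number E indep)" unfolding covering_number_def by (rule LeastI)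
  then obtain \<C> where C: "\<C> \<subseteq> bases E indep" "finite \<C>" "card \<C> = covering_number E indep"
    "\<Union>\<C> = E" by blast
  assume "covering_number E indep \<le> k"
  then have "card \<C> \<le> k" using C by simp
  obtain h where h: "bij_betw h \<C> {0..<card \<C>}" using C(2) ex_bij_betw_finite_nat by blast
  have "\<forall>e\<in>E. \<exists>B\<in>\<C>. e \<in> B" using C(4) by blast
  then obtain g where g: "\<And>e. e \<in> E \<Longrightarrow> g e \<in> \<C> \<and> e \<in> g e" by metis
  have "h (g e) < k" if "e \<in> E" for e
    using h g[OF that] \<open>card \<C> \<le> k\<close> unfolding bij_betw_def by (metis atLeastLessThan_iff image_eqI less_le_trans)
  moreover have "indep {e \<in> E. h (g e) = i}" for i
  proof (cases "\<exists>e\<in>E. h (g e) = i")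
    case True
    then obtain a where a: "a \<in> E" "h (g a) = i" by blast
    have "g e = g a" if "e \<in> E" "h (g e) = i" for e
      using h a that g unfolding bij_betw_def inj_on_def by metis
    then have "{e \<in> E. h (g e) = i} \<subseteq> g a" using g by auto
    moreover have "indep (g a)" using g[OF a(1)] C(1) by (auto simp: bases_def)
    ultimately show ?thesis using indep_subset by blast
  next
    case False
    then have "{e \<in> E. h (g e) = i} = {}" by blast
    then show ?thesis using indep_empty by (simp only:)
  qed
  ultimately show "colourable indep k E"
    unfolding colourable_def by (intro exI[of _ "\<lambda>e. h (g e)"]) auto
next
  assume "colourable indep k E"
  then obtain f where f: "\<forall>e\<in>E. f e < k" "\<forall>i<k. indep {e \<in> E. f e = i}"
    by (auto simp: colourable_def)
  have "\<forall>i<k. \<exists>B\<in>bases E indep. {e \<in> E. f e = i} \<subseteq> B"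
    using f(2) indep_subset_base by metis
  then obtain b where b: "\<And>i. i < k \<Longrightarrow> b i \<in> bases E indep \<and> {e \<in> E. f e = i} \<subseteq> b i" by metis
  have "covering_number E indep \<le> card (b ` {..<k})"
    unfolding covering_number_def
  proof (rule Least_le, intro exI conjI)
    show "b ` {..<k} \<subseteq> bases E indep" using b by auto
    show "\<Union>(b ` {..<k}) = E"
    proof
      show "\<Union>(b ` {..<k}) \<subseteq> E" using b by (force simp: bases_def)
      show "E \<subseteq> \<Union>(b ` {..<k})" using b f(1) by fastforce
    qed
  qed auto
  also have "\<dots> \<le> k" using card_image_le[of "{..<k}" b] by simp
  finally show "covering_number E indep \<le> k" .
qed

lemma loopless_matroid_restrict:
  assumes "X \<subseteq> E"
  shows "loopless_matroid X (restrict_indep indep X)"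
proof
  show "finite X" using assms finite_ground finite_subset by blast
  show "restrict_indep indep X {e}" if "e \<in> X" for e
    using that assms loopless by (auto simp: restrict_indep_def)
  show "restrict_indep indep X J" if "restrict_indep indep X I" "J \<subseteq> I" for I J
    using that indep_subset by (auto simp: restrict_indep_def)
  show "\<exists>x\<in>J - I. restrict_indep indep X (insert x I)"
    if "restrict_indep indep X I" "restrict_indep indep X J" "card I < card J" for I J
    using that augment[of I J] by (auto simp: restrict_indep_def)
qed (auto simp: restrict_indep_def indep_empty)

lemma covering_number_restrict_le_iff:
  assumes "X \<subseteq> E"
  shows "covering_number X (restrict_indep indep X) \<le> k \<longleftrightarrow> colourable indep k X"
proof -
  have "{e \<in> X. P e} \<subseteq> X" for P by blast
  then show ?thesis
    unfolding loopless_matroid.covering_number_le_iff[OF loopless_matroid_restrict[OF assms]]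
    by (simp add: colourable_def restrict_indep_def)
qed

lemma finite_densities:
  "finite {real (card X) / real (rank_fn indep X) |X. X \<subseteq> E \<and> rank_fn indep X > 0}"
  by (rule finite_subset[of _ "(\<lambda>X. real (card X) / real (rank_fn indep X)) ` Pow E"])
    (auto simp: finite_ground)

lemma max_density_le_iff:
  assumes "E \<noteq> {}"
  shows "max_density E indep \<le> c \<longleftrightarrow> (\<forall>X\<subseteq>E. real (card X) \<le> c * real (rank_fn indep X))"
proof -
  have "{real (card X) / real (rank_fn indep X) |X. X \<subseteq> E \<and> rank_fn indep X > 0} \<noteq> {}"
    using rank_pos[OF subset_refl assms] by blast
  then have "max_density E indep \<le> c \<longleftrightarrow>
    (\<forall>X\<subseteq>E. rank_fn indep X > 0 \<longrightarrow> real (card X) / real (rank_fn indep X) \<le> c)"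
    unfolding max_density_def by (subst Max_le_iff[OF finite_densities]) auto
  also have "\<dots> \<longleftrightarrow> (\<forall>X\<subseteq>E. real (card X) \<le> c * real (rank_fn indep X))"
  proof (intro all_cong)
    fix X assume X: "X \<subseteq> E"
    show "(rank_fn indep X > 0 \<longrightarrow> real (card X) / real (rank_fn indep X) \<le> c) \<longleftrightarrow>
      real (card X) \<le> c * real (rank_fn indep X)"
    \<comment> \<open>Only the empty set has rank \<open>0\<close>, and for it the product form of the inequality is trivial.\<close>
    proof (cases "X = {}")
      case True
      then have "rank_fn indep X = 0" using rank_le_card[of X] by simp
      then show ?thesis using True by simp
    next
      case False
      then show ?thesis using rank_pos[OF X] by (simp add: pos_divide_le_eq)
    qed
  qed
  finally show ?thesis .
qed

lemma covering_number_gt_iff: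
  assumes "E \<noteq> {}"
  shows "covering_number E indep > k \<longleftrightarrow> max_density E indep > real k"
proof -
  have "covering_number E indep \<le> k \<longleftrightarrow> max_density E indep \<le> real k"
    unfolding covering_number_le_iff colourable_iff_rank max_density_le_iff[OF assms]
    by (simp flip: of_nat_mult)
  then show ?thesis by linarith
qed

lemma max_coverable_eqI:
  assumes "S \<subseteq> E" "E \<noteq> {}" "k > 0"
    and min: "\<And>Y. Y \<subseteq> E \<Longrightarrow>
      card (E - S) + k * rank_fn indep S \<le> card (E - Y) + k * rank_fn indep Y"
  shows "max_coverable E indep k = card (E - S) + k * rank_fn indep S"
proof -
  let ?L = "{l. l > 0 \<and> (\<exists>X\<subseteq>E. card X = l \<and> covering_number X (restrict_indep indep X) \<le> k)}"
  have L: "l \<in> ?L \<longleftrightarrow> l > 0 \<and> (\<exists>X\<subseteq>E. card X = l \<and> colourable indep k X)" for l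
    using covering_number_restrict_le_iff by auto
  have le: "l \<le> card (E - S) + k * rank_fn indep S" if "l \<in> ?L" for l
    using that card_colourable_le unfolding L by blast
  obtain X Y where X: "colourable indep k X" "X \<subseteq> E" "Y \<subseteq> E"
    "card X = card (E - Y) + k * rank_fn indep Y" using max_colourable_set[of k] by blast
  have "card X = card (E - S) + k * rank_fn indep S"
    using min[OF X(3)] X(4) card_colourable_le[OF X(1,2), of S] by simp
  moreover have "card (E - S) + k * rank_fn indep S > 0"
  proof (cases "S = {}")
    case True
    then show ?thesis using assms(2) finite_ground by (simp add: card_gt_0_iff)
  next
    case False
    then show ?thesis using rank_pos[OF assms(1)] assms(3) by simp
  qed
  ultimately have "card (E - S) + k * rank_fn indep S \<in> ?L" unfolding L using X by auto
  moreover have "finite ?L"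
    by (rule finite_subset[of _ "{..card (E - S) + k * rank_fn indep S}"]) (use le in auto)
  ultimately show ?thesis unfolding max_coverable_def using le by (intro Max_eqI) auto
qed

end

section \<open>The universal density\<close>

text \<open>
  Functions carry the product topology, in which convex combination is continuous because it is so in
  each coordinate. Hence the hull of one more point \<open>a\<close> is a continuous image of \<open>[0, 1]\<close> times the
  old hull.
\<close>

lemma compact_convex_hull_of_finite:
  fixes A :: "('a \<Rightarrow> real) set"
  assumes "finite A"
  shows "compact (convex hull A)"
  using assms
proof (induction rule: finite_induct)
  case empty
  then show ?case by simp
next
  case (insert a A)
  show ?case
  proof (cases "A = {}")
    case True
    then show ?thesis by simp
  next
    case False
    let ?h = "\<lambda>p x. fst p * a x + (1 - fst p) * snd p x"
    have "continuous_on UNIV (\<lambda>p :: real \<times> ('a \<Rightarrow> real). snd p x)" for x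
      by (rule continuous_on_compose2[OF continuous_on_product_coordinates[of x] continuous_on_snd])
        (auto intro: continuous_intros)
    then have "continuous_on UNIV ?h"
      by (intro continuous_on_coordinatewise_then_product continuous_intros) auto
    then have "compact (?h ` ({0..1} \<times> (convex hull A)))"
      by (intro compact_continuous_image compact_Times insert.IH compact_Icc)
        (auto intro: continuous_on_subset)
    also have "?h ` ({0..1} \<times> (convex hull A)) = convex hull (insert a A)"
    proof
      show "?h ` ({0..1} \<times> (convex hull A)) \<subseteq> convex hull (insert a A)"
      proof clarify
        fix u b assume "u \<in> {0..1::real}" "b \<in> convex hull A"
        then show "?h (u, b) \<in> convex hull (insert a A)"
          unfolding convex_hull_insert[OF False]
          by (intro CollectI exI[of _ u] exI[of _ "1 - u"] exI[of _ b] conjI)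
            (auto simp: fun_eq_iff scaleR_fun_def)
      qed
      show "convex hull (insert a A) \<subseteq> ?h ` ({0..1} \<times> (convex hull A))"
      proof
        fix y assume "y \<in> convex hull (insert a A)"
        then obtain u v b where y: "0 \<le> u" "0 \<le> v" "u + v = 1" "b \<in> convex hull A"
          "y = u *\<^sub>R a + v *\<^sub>R b"
          unfolding convex_hull_insert[OF False] by blast
        then have "y = ?h (u, b)" by (auto simp: fun_eq_iff scaleR_fun_def)
        then show "y \<in> ?h ` ({0..1} \<times> (convex hull A))" using y by (intro image_eqI[of _ _ "(u, b)"]) auto
      qed
    qed
    finally show ?thesis .
  qed
qed

context matroid
begin

text \<open>
  Membership in the polytope as an explicit weighting of the bases, through which linear functionals
  of \<open>\<eta>\<close> become averages over bases.
\<close>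

lemma base_polytope_weights:
  assumes "\<eta> \<in> base_polytope E indep"
  obtains u where "\<And>B. B \<in> bases E indep \<Longrightarrow> 0 \<le> u B" "sum u (bases E indep) = 1"
    "\<eta> = (\<lambda>e. \<Sum>B\<in>bases E indep. u B * indicator B e)"
proof -
  let ?I = "indicator :: 'a set \<Rightarrow> 'a \<Rightarrow> real"
  have inj: "inj_on ?I (bases E indep)"
    by (intro inj_onI) (metis indicator_eq_1_iff subsetI subset_antisym)
  obtain w where w: "\<forall>x\<in>?I ` bases E indep. 0 \<le> w x" "sum w (?I ` bases E indep) = 1"
    "(\<Sum>x\<in>?I ` bases E indep. w x *\<^sub>R x) = \<eta>"
    using assms unfolding base_polytope_def convex_hull_finite[OF finite_imageI[OF finite_bases]] by blast
  have app: "(\<Sum>x\<in>A. g x) e = (\<Sum>x\<in>A. g x e)" for A :: "'a set set" and g :: "'a set \<Rightarrow> 'a \<Rightarrow> real" and e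
    by (induction A rule: infinite_finite_induct) auto
  show ?thesis
  proof (rule that[of "\<lambda>B. w (?I B)"])
    show "(\<Sum>B\<in>bases E indep. w (?I B)) = 1" using w(2) inj by (simp add: sum.reindex)
    show "\<eta> = (\<lambda>e. \<Sum>B\<in>bases E indep. w (?I B) * ?I B e)"
      unfolding w(3)[symmetric] sum.reindex[OF inj] by (auto simp: fun_eq_iff app scaleR_fun_def)
  qed (use w(1) in auto)
qed

lemma sum_weighted_bases:
  assumes "finite X" "\<eta> = (\<lambda>e. \<Sum>B\<in>bases E indep. u B * indicator B e)"
  shows "(\<Sum>e\<in>X. g e * \<eta> e) = (\<Sum>B\<in>bases E indep. u B * (\<Sum>e\<in>B \<inter> X. g e :: real))"
proof -
  have "(\<Sum>e\<in>X. g e * \<eta> e) = (\<Sum>e\<in>X. \<Sum>B\<in>bases E indep. u B * (g e * indicator B e))"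
    unfolding assms(2) by (simp add: sum_distrib_left mult_ac)
  also have "\<dots> = (\<Sum>B\<in>bases E indep. u B * (\<Sum>e\<in>X. g e * indicator B e))"
    by (subst sum.swap) (simp add: sum_distrib_left)
  also have "\<dots> = (\<Sum>B\<in>bases E indep. u B * (\<Sum>e\<in>B \<inter> X. g e))"
    using assms(1) by (simp add: sum.inter_restrict[symmetric] Int_commute indicator_def if_distrib cong: if_cong)
  finally show ?thesis .
qed

lemma base_polytope_zero: "\<eta> \<in> base_polytope E indep \<Longrightarrow> e \<notin> E \<Longrightarrow> \<eta> e = 0"
  by (erule base_polytope_weights) (auto simp: bases_def indicator_def intro!: sum.neutral)

lemma base_polytope_sum_le_rank:
  assumes "\<eta> \<in> base_polytope E indep" "X \<subseteq> E"
  shows "sum \<eta> X \<le> rank_fn indep X"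
proof -
  obtain u where u: "\<And>B. B \<in> bases E indep \<Longrightarrow> 0 \<le> u B" "sum u (bases E indep) = 1"
    "\<eta> = (\<lambda>e. \<Sum>B\<in>bases E indep. u B * indicator B e)"
    using base_polytope_weights[OF assms(1)] by blast
  have "finite X" using assms(2) finite_ground finite_subset by blast
  then have "sum \<eta> X = (\<Sum>B\<in>bases E indep. u B * card (B \<inter> X))"
    using sum_weighted_bases[OF _ u(3), of X "\<lambda>_. 1"] by simp
  also have "\<dots> \<le> (\<Sum>B\<in>bases E indep. u B * rank_fn indep X)"
  proof (intro sum_mono mult_left_mono u(1))
    fix B assume "B \<in> bases E indep"
    then have "indep (B \<inter> X)" using indep_subset[of B "B \<inter> X"] by (auto simp: bases_def)
    then show "real (card (B \<inter> X)) \<le> real (rank_fn indep X)"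
      by (simp add: card_indep_le_rank)
  qed
  also have "\<dots> = rank_fn indep X" using u(2) by (simp flip: sum_distrib_right)
  finally show ?thesis .
qed

definition least_norm :: "('a \<Rightarrow> real) \<Rightarrow> bool" where
  "least_norm \<eta> \<longleftrightarrow> \<eta> \<in> base_polytope E indep \<and>
    (\<forall>\<eta>'\<in>base_polytope E indep. (\<Sum>e\<in>E. (\<eta> e)\<^sup>2) \<le> (\<Sum>e\<in>E. (\<eta>' e)\<^sup>2))"

lemma least_norm_exists: "\<exists>\<eta>. least_norm \<eta>"
proof -
  have "compact (base_polytope E indep)"
    unfolding base_polytope_def by (intro compact_convex_hull_of_finite finite_imageI finite_bases)
  moreover have "base_polytope E indep \<noteq> {}"
    unfolding base_polytope_def using bases_nonempty by simp
  moreover have "continuous_on (base_polytope E indep) (\<lambda>\<eta>. \<Sum>e\<in>E. (\<eta> e)\<^sup>2)"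
    by (intro continuous_intros continuous_on_subset[OF continuous_on_product_coordinates]) auto
  ultimately show ?thesis
    unfolding least_norm_def using continuous_attains_inf by blast
qed

text \<open>
  First-order optimality: moving from \<open>\<eta>\<close> a little way towards any other point of the polytope
  cannot decrease the norm, so the directional derivative is nonnegative.
\<close>

lemma least_norm_variational:
  assumes "least_norm \<eta>" "\<eta>' \<in> base_polytope E indep"
  shows "(\<Sum>e\<in>E. \<eta> e * \<eta> e) \<le> (\<Sum>e\<in>E. \<eta> e * \<eta>' e)"
proof (rule ccontr)
  define a where "a = (\<Sum>e\<in>E. \<eta> e * (\<eta>' e - \<eta> e))"
  define b where "b = (\<Sum>e\<in>E. (\<eta>' e - \<eta> e)\<^sup>2)"
  assume "\<not> ?thesis"
  then have a: "a < 0" by (simp add: a_def algebra_simps sum_subtractf)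
  have b: "b \<ge> 0" unfolding b_def by (intro sum_nonneg) auto
  \<comment> \<open>The norm changes by \<open>t * (2 * a + t * b)\<close> along the segment; this step is short enough for the
    linear term to dominate and still stays on the segment.\<close>
  define t where "t = min 1 (- a / (b + 1))"
  have t: "0 < t" "t \<le> 1" using a b by (auto simp: t_def divide_neg_pos)
  have "t * b \<le> - a / (b + 1) * b" using b by (intro mult_right_mono) (auto simp: t_def)
  also have "\<dots> \<le> - a"
  proof -
    have "- a * b \<le> - a * (b + 1)" using a by (intro mult_left_mono) auto
    then show ?thesis using b by (simp add: pos_le_divide_eq)
  qed
  finally have tb: "2 * a + t * b < 0" using a by linarith
  define \<zeta> where "\<zeta> = (1 - t) *\<^sub>R \<eta> + t *\<^sub>R \<eta>'"
  have "\<zeta> \<in> base_polytope E indep"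
    using assms t unfolding \<zeta>_def base_polytope_def least_norm_def
    by (intro convexD[OF convex_convex_hull]) auto
  then have "(\<Sum>e\<in>E. (\<eta> e)\<^sup>2) \<le> (\<Sum>e\<in>E. (\<zeta> e)\<^sup>2)"
    using assms(1) by (simp add: least_norm_def)
  also have "\<dots> = (\<Sum>e\<in>E. (\<eta> e)\<^sup>2 + t * (2 * (\<eta> e * (\<eta>' e - \<eta> e)) + t * (\<eta>' e - \<eta> e)\<^sup>2))"
  proof (rule sum.cong[OF refl])
    fix e
    have \<zeta>: "\<zeta> e = \<eta> e + t * (\<eta>' e - \<eta> e)"
      by (simp add: \<zeta>_def scaleR_fun_def algebra_simps)
    show "(\<zeta> e)\<^sup>2 = (\<eta> e)\<^sup>2 + t * (2 * (\<eta> e * (\<eta>' e - \<eta> e)) + t * (\<eta>' e - \<eta> e)\<^sup>2)"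
      unfolding \<zeta> by (simp add: power2_eq_square algebra_simps)
  qed
  also have "\<dots> = (\<Sum>e\<in>E. (\<eta> e)\<^sup>2) + t * (2 * a + t * b)"
    by (simp add: a_def b_def sum.distrib flip: sum_distrib_left)
  finally have "0 \<le> t * (2 * a + t * b)" by simp
  then show False using t tb by (simp add: zero_le_mult_iff)
qed

text \<open>
  The first-order conditions at two minimizers, each tested on the other one, add up to
  \<open>\<Sum>(\<eta> - \<eta>')\<^sup>2 \<le> 0\<close>.
\<close>

lemma least_norm_unique:
  assumes "least_norm \<eta>" "least_norm \<eta>'"
  shows "\<eta> = \<eta>'"
proof
  fix x
  have "\<eta> \<in> base_polytope E indep" "\<eta>' \<in> base_polytope E indep"
    using assms by (auto simp: least_norm_def)
  note mem = this
  have "(\<Sum>e\<in>E. (\<eta> e - \<eta>' e)\<^sup>2) =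
    (\<Sum>e\<in>E. \<eta> e * \<eta> e) - (\<Sum>e\<in>E. \<eta> e * \<eta>' e) + ((\<Sum>e\<in>E. \<eta>' e * \<eta>' e) - (\<Sum>e\<in>E. \<eta>' e * \<eta> e))"
    by (simp add: power2_eq_square algebra_simps flip: sum_subtractf sum.distrib)
  also have "\<dots> \<le> 0"
    using least_norm_variational[OF assms(1) mem(2)] least_norm_variational[OF assms(2) mem(1)] by linarith
  finally have "(\<Sum>e\<in>E. (\<eta> e - \<eta>' e)\<^sup>2) = 0"
    by (intro antisym sum_nonneg) auto
  then have "\<forall>e\<in>E. \<eta> e = \<eta>' e"
    by (subst (asm) sum_nonneg_eq_0_iff) (auto simp: finite_ground)
  then show "\<eta> x = \<eta>' x"
    using base_polytope_zero[OF mem(1)] base_polytope_zero[OF mem(2)] by (cases "x \<in> E") auto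
qed

lemma universal_density_least_norm: "least_norm (universal_density E indep)"
proof -
  have "\<exists>!\<eta>. least_norm \<eta>" using least_norm_exists least_norm_unique by blast
  then have "least_norm (THE \<eta>. least_norm \<eta>)" by (rule theI')
  then show ?thesis by (simp add: universal_density_def least_norm_def)
qed

text \<open>
  Augment \<open>B \<inter> S\<close> by some \<open>f\<close> of \<open>S\<close> and fill up with elements of \<open>B\<close>. The resulting base
  contains \<open>B \<inter> S\<close>, so the one element of \<open>B\<close> that it drops lies outside \<open>S\<close>.
\<close>

lemma base_exchange_into:
  assumes B: "B \<in> bases E indep" and S: "card (B \<inter> S) < rank_fn indep S"
  obtains e f where "e \<in> B - S" "f \<in> S - B" "insert f (B - {e}) \<in> bases E indep"
proof -
  have iB: "indep B" and cB: "card B = rank_fn indep E" using B bases_iff by auto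
  obtain J where J: "indep J" "J \<subseteq> S" "card J = rank_fn indep S" by (rule rank_attained)
  have BS: "indep (B \<inter> S)" using iB by (rule indep_subset) simp
  have "card (B \<inter> S) < card J" using S J by simp
  then obtain f where f: "f \<in> J - B \<inter> S" "indep (insert f (B \<inter> S))"
    using augment[OF BS J(1)] by blast
  have "card (insert f (B \<inter> S)) \<le> card B"
    using card_indep_le_rank[OF f(2) indep_subset_ground[OF f(2)]] cB by simp
  then obtain K where K: "insert f (B \<inter> S) \<subseteq> K" "K \<subseteq> insert f (B \<inter> S) \<union> B" "indep K"
    "card K = card B"
    using indep_extend[OF f(2) iB] by blast
  obtain e where e: "e \<in> B" "e \<notin> K" "K = insert f (B - {e})"
    using single_exchange[of B K f] K f J iB finite_indep by blast
  have "K \<in> bases E indep" using K cB bases_iff by simp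
  then show ?thesis using that[of e f] e K f J by blast
qed

text \<open>
  The level sets of the universal density are tight. By first-order optimality every base has
  \<open>\<eta>\<close>-weight at least \<open>\<Sum>\<eta>\<^sup>2\<close>, and the bases that carry \<open>\<eta>\<close> average to this value, so each of them
  attains it. A base that does not span the level set could exchange an element outside of it for
  a strictly lighter one inside, so it is not among them.
\<close>

lemma level_set_tight:
  assumes \<eta>: "least_norm \<eta>" and S: "S = {e \<in> E. \<eta> e \<le> t}"
  shows "sum \<eta> S = rank_fn indep S"
proof -
  have mem: "\<eta> \<in> base_polytope E indep" using \<eta> by (simp add: least_norm_def)
  obtain u where u: "\<And>B. B \<in> bases E indep \<Longrightarrow> 0 \<le> u B" "sum u (bases E indep) = 1"
    "\<eta> = (\<lambda>e. \<Sum>B\<in>bases E indep. u B * indicator B e)"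
    using base_polytope_weights[OF mem] by blast
  define w where "w = (\<Sum>e\<in>E. \<eta> e * \<eta> e)"
  have weight_ge: "w \<le> sum \<eta> B" if B: "B \<in> bases E indep" for B
  proof -
    have "indicator B \<in> base_polytope E indep"
      unfolding base_polytope_def using B by (intro hull_inc) auto
    then have "w \<le> (\<Sum>e\<in>E. \<eta> e * indicator B e)"
      unfolding w_def by (rule least_norm_variational[OF \<eta>])
    also have "\<dots> = sum \<eta> B"
      using B finite_ground
      by (simp add: bases_def indicator_def if_distrib sum.If_cases Int_absorb1 cong: if_cong)
    finally show ?thesis .
  qed
  have "w = (\<Sum>B\<in>bases E indep. u B * sum \<eta> (B \<inter> E))"
    unfolding w_def by (rule sum_weighted_bases[OF finite_ground u(3)])
  also have "\<dots> = (\<Sum>B\<in>bases E indep. u B * sum \<eta> B)"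
    by (intro sum.cong refl) (auto simp: bases_def Int_absorb2)
  finally have "(\<Sum>B\<in>bases E indep. u B * (sum \<eta> B - w)) = 0"
    using u(2) by (simp add: right_diff_distrib sum_subtractf flip: sum_distrib_right)
  then have carry: "\<forall>B\<in>bases E indep. u B * (sum \<eta> B - w) = 0"
    by (subst (asm) sum_nonneg_eq_0_iff) (auto simp: finite_bases u(1) weight_ge)
  have full: "card (B \<inter> S) = rank_fn indep S" if B: "B \<in> bases E indep" and pos: "u B \<noteq> 0" for B
  proof (rule ccontr)
    have iB: "indep B" using B by (simp add: bases_def)
    then have "indep (B \<inter> S)" by (rule indep_subset) simp
    then have "card (B \<inter> S) \<le> rank_fn indep S" by (rule card_indep_le_rank) simp
    moreover assume "card (B \<inter> S) \<noteq> rank_fn indep S"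
    ultimately have "card (B \<inter> S) < rank_fn indep S" by simp
    then obtain e f where ef: "e \<in> B - S" "f \<in> S - B" "insert f (B - {e}) \<in> bases E indep"
      using base_exchange_into[OF B] by blast
    have "e \<in> E" using ef B by (auto simp: bases_def)
    then have "\<eta> f < \<eta> e" using ef S by auto
    moreover have "sum \<eta> (insert f (B - {e})) = sum \<eta> B - \<eta> e + \<eta> f"
      using ef finite_indep[OF iB] by (simp add: sum_diff1)
    moreover have "sum \<eta> B = w" using carry B pos by auto
    ultimately show False using weight_ge[OF ef(3)] by simp
  qed
  have "finite S" using S finite_ground by simp
  then have "sum \<eta> S = (\<Sum>B\<in>bases E indep. u B * card (B \<inter> S))"
    using sum_weighted_bases[OF _ u(3), of S "\<lambda>_. 1"] by simp
  also have "\<dots> = (\<Sum>B\<in>bases E indep. u B * rank_fn indep S)"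
    using full by (intro sum.cong refl) auto
  also have "\<dots> = rank_fn indep S" using u(2) by (simp flip: sum_distrib_right)
  finally show ?thesis .
qed

text \<open>
  The sum of \<open>k \<eta>(e) - 1\<close> over \<open>Y\<close> bounds \<open>k r(Y) - |Y|\<close> from below, is least at \<open>S\<close>, where the
  summand is nonpositive, and at \<open>S\<close> the bound is attained by tightness.
\<close>

lemma level_set_minimizes:
  assumes \<eta>: "least_norm \<eta>" and S: "S = {e \<in> E. \<eta> e \<le> 1 / real k}" and "k > 0" and Y: "Y \<subseteq> E"
  shows "card (E - S) + k * rank_fn indep S \<le> card (E - Y) + k * rank_fn indep Y"
proof -
  define h where "h e = real k * \<eta> e - 1" for e
  have SE: "S \<subseteq> E" using S by auto
  have sign: "h e \<le> 0 \<longleftrightarrow> e \<in> S" if "e \<in> E" for e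
    using that S \<open>k > 0\<close> by (simp add: h_def field_simps)
  have fin: "finite X" if "X \<subseteq> E" for X using that finite_ground finite_subset by blast
  have sum_h: "sum h X = k * sum \<eta> X - card X" for X
    by (simp add: h_def sum_subtractf sum_distrib_left)
  have card_compl: "real (card (E - X)) = real (card E) - real (card X)" if "X \<subseteq> E" for X
    using that fin by (simp add: card_Diff_subset card_mono of_nat_diff finite_ground)
  have "sum h S \<le> sum h (S \<inter> Y)"
  proof -
    have "sum h S = sum h (S \<inter> Y) + sum h (S - Y)"
      using fin[OF SE] by (rule sum.Int_Diff)
    moreover have "sum h (S - Y) \<le> 0" using sign SE by (intro sum_nonpos) auto
    ultimately show ?thesis by simp
  qed
  also have "\<dots> \<le> sum h Y"
    using fin[OF Y] sign Y by (intro sum_mono2) force+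
  finally have "k * sum \<eta> S - card S \<le> k * sum \<eta> Y - card Y" by (simp add: sum_h)
  moreover have "k * sum \<eta> Y \<le> k * rank_fn indep Y"
    using base_polytope_sum_le_rank[of \<eta> Y] \<eta> Y
    by (simp add: least_norm_def mult_left_mono)
  ultimately have "real (card (E - S) + k * rank_fn indep S) \<le> real (card (E - Y) + k * rank_fn indep Y)"
    using level_set_tight[OF \<eta> S] card_compl[OF SE] card_compl[OF Y] by simp
  then show ?thesis by (simp only: of_nat_le_iff)
qed

end

context loopless_matroid
begin

text \<open>
  The set where the universal density is least is a level set, so tightness says that it is as
  dense as \<open>1 / \<eta> a\<close>, while the rank bound on \<open>\<eta>\<close> shows that no set is denser.
\<close>

lemma min_universal_density:
  assumes \<eta>: "least_norm \<eta>" and a: "a \<in> E" and le: "\<And>e. e \<in> E \<Longrightarrow> \<eta> a \<le> \<eta> e"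
  shows "\<eta> a = 1 / max_density E indep"
proof -
  define S where "S = {e \<in> E. \<eta> e \<le> \<eta> a}"
  have S: "a \<in> S" "S \<subseteq> E" using a by (auto simp: S_def)
  have "sum \<eta> S = real (rank_fn indep S)" using level_set_tight[OF \<eta> S_def] .
  moreover have "sum \<eta> S = (\<Sum>e\<in>S. \<eta> a)" using le by (intro sum.cong) (auto simp: S_def intro: antisym)
  ultimately have eq: "card S * \<eta> a = rank_fn indep S" by simp
  have rpos: "rank_fn indep S > 0" using S by (intro rank_pos) auto
  then have pos: "\<eta> a > 0" using eq
    by (metis of_nat_0_less_iff of_nat_0_le_iff zero_less_mult_pos less_eq_real_def mult_zero_left)
  have E: "E \<noteq> {}" using a by auto
  have "max_density E indep \<le> 1 / \<eta> a"
    unfolding max_density_le_iff[OF E]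
  proof (intro allI impI)
    fix X assume X: "X \<subseteq> E"
    have "card X * \<eta> a = (\<Sum>e\<in>X. \<eta> a)" by simp
    also have "\<dots> \<le> sum \<eta> X" using le X by (intro sum_mono) auto
    also have "\<dots> \<le> rank_fn indep X"
      using \<eta> X by (intro base_polytope_sum_le_rank) (auto simp: least_norm_def)
    finally show "real (card X) \<le> 1 / \<eta> a * real (rank_fn indep X)"
      using pos by (simp add: field_simps)
  qed
  moreover have "1 / \<eta> a \<le> max_density E indep"
  proof -
    have "real (card S) \<le> max_density E indep * real (rank_fn indep S)"
      using max_density_le_iff[OF E, of "max_density E indep"] S by simp
    then have "real (card S) \<le> max_density E indep * (card S * \<eta> a)" using eq by simp
    moreover have "card S > 0" using S finite_ground by (metis card_gt_0_iff empty_iff finite_subset)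
    ultimately have "1 \<le> max_density E indep * \<eta> a"
      by (simp add: mult.left_commute)
    then show ?thesis using pos by (simp add: field_simps)
  qed
  ultimately have "max_density E indep = 1 / \<eta> a" by simp
  then show ?thesis by simp
qed

end

theorem theorem7p4:
  fixes E :: "'a set" and indep :: "'a set \<Rightarrow> bool" and k m :: nat
    and \<eta> :: "'a \<Rightarrow> real" and v :: "nat \<Rightarrow> real" and S :: "nat \<Rightarrow> 'a set"
  assumes "loopless_matroid E indep" and "rank_fn indep E > 0" and "k > 0"
    and "\<eta> = universal_density E indep"
    and "strict_mono_on {1..m} v" and "v ` {1..m} = \<eta> ` E"
    and "\<forall>i\<in>{1..m}. S i = {e \<in> E. \<eta> e \<le> v i}"
  shows "(covering_number E indep > k \<longleftrightarrow> max_density E indep > real k) \<and>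
    (covering_number E indep > k \<longrightarrow>
       v 1 = 1 / max_density E indep \<and> 1 / max_density E indep < 1 / real k \<and>
       (let i = (GREATEST i. i \<in> {1..m} \<and> v i \<le> 1 / real k)
        in max_coverable E indep k = card (E - S i) + k * rank_fn indep (S i)))"
proof -
  interpret loopless_matroid E indep by fact
  have E: "E \<noteq> {}" using assms(2) rank_le_card[of "{}"] by auto
  have \<eta>: "least_norm \<eta>" unfolding assms(4) by (rule universal_density_least_norm)
  have v_mono: "v i \<le> v j" if "i \<in> {1..m}" "j \<in> {1..m}" "i \<le> j" for i j
    using assms(5) that by (metis strict_mono_on_leD)
  have "v ` {1..m} \<noteq> {}" using assms(6) E by simp
  then have m: "1 \<in> {1..m}" by simp
  then obtain a where a: "a \<in> E" "v 1 = \<eta> a" using assms(6) by (metis imageE image_eqI)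
  have "v 1 \<le> \<eta> e" if e: "e \<in> E" for e
  proof -
    obtain j where "j \<in> {1..m}" "\<eta> e = v j" using e assms(6) by (metis imageE image_eqI)
    then show ?thesis using v_mono[of 1 j] m by simp
  qed
  then have v1: "v 1 = 1 / max_density E indep"
    using a min_universal_density[OF \<eta> a(1)] by simp
  show ?thesis
  proof (intro conjI impI covering_number_gt_iff[OF E] v1)
    assume "covering_number E indep > k"
    then have "max_density E indep > real k" using covering_number_gt_iff[OF E] by simp
    then show lt: "1 / max_density E indep < 1 / real k"
      using assms(3) by (intro divide_strict_left_mono) auto
    let ?P = "\<lambda>i. i \<in> {1..m} \<and> v i \<le> 1 / real k"
    define i where "i = (GREATEST i. ?P i)"
    have "?P 1" using m v1 lt by simp
    then have i: "?P i" and greatest: "\<And>j. ?P j \<Longrightarrow> j \<le> i"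
      unfolding i_def by (rule GreatestI_nat[where b = m], simp)
        (rule Greatest_le_nat[where b = m], auto)
    have "S i = {e \<in> E. \<eta> e \<le> 1 / real k}"
    proof -
      have "\<eta> e \<le> v i" if e: "e \<in> E" "\<eta> e \<le> 1 / real k" for e
      proof -
        obtain j where j: "j \<in> {1..m}" "\<eta> e = v j" using e assms(6) by (metis imageE image_eqI)
        then show ?thesis using v_mono[of j i] greatest[of j] i e by simp
      qed
      then show ?thesis using assms(7) i by force
    qed
    then have "max_coverable E indep k = card (E - S i) + k * rank_fn indep (S i)"
      using level_set_minimizes[OF \<eta> _ assms(3)] E assms(3) by (intro max_coverable_eqI) auto
    then show "let i = (GREATEST i. ?P i)
      in max_coverable E indep k = card (E - S i) + k * rank_fn indep (S i)"
      by (simp only: Let_def i_def)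
  qed
qed

end
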